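(* Consider $\mathbb{Z}_{12}$ with the symmetric generating set $S=\{3,4,8,9\}$ and let $K'=\{0\}\cup S=\{0,3,4,8,9\}$. There exist exactly four partitions $(K_i,D_i)_{i=1}^4$ of $\mathbb{Z}_{12}$ (i.e. $K_i\cap D_i=\emptyset$, $K_i\cup D_i=\mathbb{Z}_{12}$) such that $K'\subset K_i$ and there exists a unique affine transformation $T_i:\mathbb{Z}_{12}\to\mathbb{Z}_{12}$ satisfying $$T_i^2=\mathrm{Id},\qquad T_i(K_i)=D_i,\qquad T_i \text{ is an isometry of the unoriented Cayley graph of } \mathbb{Z}_{12} \text{ w.r.t. } S,$$ for each $i\in\{1,2,3,4\}$. These partitions are $K_1=\{0,3,4,7,8,9\}$, $D_1=\{1,2,5,6,10,11\}$ and $K_2=\{0,1,3,4,8,9\}$, $D_2=\{2,5,6,7,10,11\}$, both corresponding to the unique affine map $T(x)=5x\oplus 2$; and $K_3=\{0,3,4,5,8,9\}$, $D_3=\{1,2,6,7,10,11\}$ and $K_4=\{0,3,4,8,9,11\}$, $D_4=\{1,2,5,6,7,10\}$, both corresponding to the unique affine map $T(x)=5x\oplus 10$.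
   Context: $\mathbb{Z}_{12}=\{0,\dots,11\}$ with $a\oplus b=(a+b)\bmod 12$; $5x$ means $5x \bmod 12$. An affine transformation of $\mathbb{Z}_{12}$ is a map $T(x)=f(x)\oplus w$ with $f$ a group automorphism of $(\mathbb{Z}_{12},\oplus)$ and $w\in\mathbb{Z}_{12}$. The unoriented Cayley graph distance $d$ w.r.t. $S$: $d(g,g)=0$ and for $g\ne h$, $d(g,h)$ is the least $k$ such that there are $x_0=g,\dots,x_k=h$ with $x_{i+1}\ominus x_i\in S$ for all $i$. $T$ is an isometry if $d(T(x),T(y))=d(x,y)$ for all $x,y$. *)

theory Defs
  imports "HOL-Library.Numeral_Type"
begin

text \<open>
  The group of integers modulo 12 is the library type \<open>12\<close> (its elements are the residues
  \<open>0, \<dots>, 11\<close>), whose \<open>+\<close>, \<open>-\<close> and \<open>*\<close> are the operations modulo 12.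
\<close>

definition group_automorphism :: "('g::ab_group_add \<Rightarrow> 'g) \<Rightarrow> bool" where
  "group_automorphism f \<longleftrightarrow> bij f \<and> (\<forall>x y. f (x + y) = f x + f y)"

definition affine_transformation :: "('g::ab_group_add \<Rightarrow> 'g) \<Rightarrow> bool" where
  "affine_transformation T \<longleftrightarrow> (\<exists>f w. group_automorphism f \<and> T = (\<lambda>x. f x + w))"

definition cayley_walk :: "'g::ab_group_add set \<Rightarrow> nat \<Rightarrow> 'g \<Rightarrow> 'g \<Rightarrow> bool" where
  "cayley_walk S k g h \<longleftrightarrow>
     (\<exists>x :: nat \<Rightarrow> 'g. x 0 = g \<and> x k = h \<and> (\<forall>i<k. x (Suc i) - x i \<in> S))"

text \<open>
  The \<open>LEAST\<close> below is meaningful only if \<open>h\<close> can be reached from \<open>g\<close>; for the generating set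
  \<open>{3, 4, 8, 9}\<close> of \<open>12\<close> this always holds, see \<open>cayley_walk_exists\<close>.
\<close>

definition cayley_dist :: "'g::ab_group_add set \<Rightarrow> 'g \<Rightarrow> 'g \<Rightarrow> nat" where
  "cayley_dist S g h = (if g = h then 0 else (LEAST k. cayley_walk S k g h))"

definition cayley_isometry :: "'g::ab_group_add set \<Rightarrow> ('g \<Rightarrow> 'g) \<Rightarrow> bool" where
  "cayley_isometry S T \<longleftrightarrow> (\<forall>x y. cayley_dist S (T x) (T y) = cayley_dist S x y)"

definition is_bipartition :: "'g set \<Rightarrow> 'g set \<Rightarrow> bool" where
  "is_bipartition K D \<longleftrightarrow> K \<inter> D = {} \<and> K \<union> D = UNIV"

definition swapping_affine_isometry ::
    "'g::ab_group_add set \<Rightarrow> 'g set \<Rightarrow> 'g set \<Rightarrow> ('g \<Rightarrow> 'g) \<Rightarrow> bool" where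
  "swapping_affine_isometry S K D T \<longleftrightarrow>
     affine_transformation T \<and> T \<circ> T = id \<and> T ` K = D \<and> cayley_isometry S T"

lemma symmetric_generators: "uminus ` {3, 4, 8, 9 :: 12} = {3, 4, 8, 9}"
  by auto

lemma cayley_walk_add:
  assumes "cayley_walk S k g h" and "s \<in> S"
  shows "cayley_walk S (Suc k) g (h + s)"
proof -
  obtain x where x: "x 0 = g" "x k = h" "\<forall>i<k. x (Suc i) - x i \<in> S"
    using assms(1) unfolding cayley_walk_def by blast
  show ?thesis
    unfolding cayley_walk_def
    by (rule exI[of _ "x(Suc k := h + s)"]) (use x assms(2) in \<open>auto simp: less_Suc_eq\<close>)
qed

lemma cayley_walk_exists:
  fixes g h :: 12
  shows "\<exists>k. cayley_walk {3, 4, 8, 9} k g h"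
proof -
  have step: "\<exists>k. cayley_walk {3, 4, 8, 9} k g (g + of_nat n)" for n
  proof (induction n)
    case 0
    have "cayley_walk {3, 4, 8, 9} 0 g g" by (auto simp: cayley_walk_def)
    then show ?case by auto
  next
    case (Suc n)
    then obtain k where "cayley_walk {3, 4, 8, 9} k g (g + of_nat n)" by blast
    then have "cayley_walk {3, 4, 8, 9} (Suc (Suc k)) g (g + of_nat n + 4 + 9)"
      by (intro cayley_walk_add) auto
    moreover have "g + of_nat n + 4 + 9 = g + of_nat (Suc n)"
      by (simp add: add.assoc add.left_commute)
    ultimately show ?case by metis
  qed
  obtain z where z: "h - g = of_int z" "0 \<le> z" by (cases "h - g" rule: bit0.cases) auto
  then have "h = g + of_nat (nat z)" by (simp add: algebra_simps)
  with step[of "nat z"] show ?thesis by simp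
qed

end

theory Submission
  imports Defs
begin

text \<open>
  An affine involution has the form \<open>T x = a * x + w\<close> with \<open>a\<^sup>2 = 1\<close> and \<open>(a + 1) * w = 0\<close>. Multiplication
  by such an \<open>a\<close> preserves \<open>K'\<close>, so \<open>T\<close> can move \<open>K'\<close> off itself only if \<open>w\<close> is not a difference
  of elements of \<open>K'\<close>, which leaves \<open>w = 2\<close> and \<open>w = 10\<close>. Then \<open>a\<close> is 5 or 11, and \<open>a = 11\<close>
  is impossible because \<open>T\<close> would have a fixed point. Since \<open>T\<close> exchanges \<open>K\<close> and its complement,
  \<open>K\<close> is determined by \<open>K'\<close> up to one two-element orbit of \<open>T\<close>, of which it contains one point.
\<close>

lemma cases_12:
  fixes x :: 12
  shows "x \<in> {0, 1, 2, 3, 4, 5, 6, 7, 8, 9, 10, 11}"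
proof (cases x rule: bit0.cases)
  case (1 z)
  then have "z \<in> set [0..11]" by simp
  also have "[0..11 :: int] = [0, 1, 2, 3, 4, 5, 6, 7, 8, 9, 10, 11]" by (simp add: upto_rec1)
  finally have "z \<in> {0, 1, 2, 3, 4, 5, 6, 7, 8, 9, 10, 11}" by simp
  with 1 show ?thesis by auto
qed

lemma all_12_iff:
  "(\<forall>x :: 12. P x) \<longleftrightarrow> P 0 \<and> P 1 \<and> P 2 \<and> P 3 \<and> P 4 \<and> P 5 \<and> P 6 \<and> P 7 \<and> P 8 \<and> P 9 \<and> P 10 \<and> P 11"
  (is "?L \<longleftrightarrow> ?R")
proof
  assume ?R
  show ?L
  proof
    fix x :: 12
    show "P x" using cases_12[of x] \<open>?R\<close> by (elim insertE emptyE) simp_all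
  qed
qed simp

text \<open>Simp decides equations between numerals of type \<open>12\<close> but does not reduce a
  numeral to its residue, as is needed for the argument in facts such as
  \<open>17 \<in> K\<close>.\<close>

lemma numerals_mod_12:
  "13 = (1 :: 12)"
  "14 = (2 :: 12)"
  "15 = (3 :: 12)"
  "17 = (5 :: 12)"
  "18 = (6 :: 12)"
  "19 = (7 :: 12)"
  "20 = (8 :: 12)"
  "22 = (10 :: 12)"
  "25 = (1 :: 12)"
  "27 = (3 :: 12)"
  "30 = (6 :: 12)"
  "35 = (11 :: 12)"
  "40 = (4 :: 12)"
  "42 = (6 :: 12)"
  "45 = (9 :: 12)"
  "47 = (11 :: 12)"
  "50 = (2 :: 12)"
  "55 = (7 :: 12)"
  by simp_all

text \<open>The element 1 generates the group, so \<open>f\<close> is determined by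
  \<open>f 1\<close>.\<close>

lemma additive_12:
  fixes f :: "12 \<Rightarrow> 12"
  assumes add: "\<And>x y. f (x + y) = f x + f y"
  shows "f x = f 1 * x"
proof -
  have "f 0 = 0" using add[of 0 0] by simp
  then have nat: "f (of_nat n) = f 1 * of_nat n" for n
    by (induction n) (simp_all add: add algebra_simps)
  obtain z where "x = of_int z" "0 \<le> z" by (cases x rule: bit0.cases) auto
  then have "x = of_nat (nat z)" by simp
  with nat show ?thesis by metis
qed

text \<open>With \<open>a = f 1\<close>, the two equations are \<open>T (T 0) = 0\<close> and
  \<open>T (T 1) = 1\<close>. Conversely, \<open>a * a = 1\<close> makes multiplication by
  \<open>a\<close> its own inverse, hence an automorphism.\<close>

lemma affine_transformation_12_iff:
  fixes T :: "12 \<Rightarrow> 12"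
  assumes "T \<circ> T = id"
  shows "affine_transformation T \<longleftrightarrow> (\<exists>a w. a * a = 1 \<and> a * w + w = 0 \<and> T = (\<lambda>x. a * x + w))"
proof
  assume "affine_transformation T"
  then obtain f w where f: "group_automorphism f" and T: "T = (\<lambda>x. f x + w)"
    unfolding affine_transformation_def by blast
  have "f x = f 1 * x" for x
    by (rule additive_12) (use f in \<open>simp add: group_automorphism_def\<close>)
  then have *: "T = (\<lambda>x. f 1 * x + w)"
    unfolding T by (intro ext arg_cong[of _ _ "\<lambda>y. y + w"])
  have TT: "T (T x) = x" for x using assms by (simp add: fun_eq_iff)
  have w: "f 1 * w + w = 0" using TT[of 0] by (simp add: *)
  have "f 1 * f 1 = f 1 * f 1 + (f 1 * w + w)" using w by simp
  also have "\<dots> = T (T 1)" by (simp add: * algebra_simps)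
  finally have "f 1 * f 1 = 1" using TT by simp
  with w * show "\<exists>a w. a * a = 1 \<and> a * w + w = 0 \<and> T = (\<lambda>x. a * x + w)" by blast
next
  assume "\<exists>a w. a * a = 1 \<and> a * w + w = 0 \<and> T = (\<lambda>x. a * x + w)"
  then obtain a w where a: "a * a = 1" and T: "T = (\<lambda>x. a * x + w)" by blast
  have "a * (a * x) = x" for x using a by (metis mult.assoc mult_1)
  then have "bij ((*) a)" by (intro o_bij[of "(*) a"]) (simp_all add: fun_eq_iff)
  then have "group_automorphism ((*) a)"
    by (simp add: group_automorphism_def algebra_simps)
  with T show "affine_transformation T" unfolding affine_transformation_def by blast
qed

lemma cayley_walk_map:
  assumes "\<And>x y. y - x \<in> S \<Longrightarrow> T y - T x \<in> S" and "cayley_walk S k g h"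
  shows "cayley_walk S k (T g) (T h)"
proof -
  obtain x where "x 0 = g" "x k = h" "\<forall>i<k. x (Suc i) - x i \<in> S"
    using assms(2) unfolding cayley_walk_def by blast
  then show ?thesis
    unfolding cayley_walk_def by (intro exI[of _ "T \<circ> x"]) (simp add: assms(1))
qed

text \<open>\<open>T\<close> carries walks to walks of the same length, and so does its inverse,
  which is \<open>T\<close> itself. Hence both pairs of endpoints admit the same walk lengths, and
  the \<open>LEAST\<close> values agree even without reachability.\<close>

lemma involution_cayley_isometry:
  assumes S: "\<And>x y. y - x \<in> S \<Longrightarrow> T y - T x \<in> S" and "T \<circ> T = id"
  shows "cayley_isometry S T"
proof -
  have TT: "T (T x) = x" for x using assms(2) by (simp add: fun_eq_iff)
  then have "T g = T h \<longleftrightarrow> g = h" for g h by metis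
  moreover have "cayley_walk S k (T g) (T h) \<longleftrightarrow> cayley_walk S k g h" for k g h
    using cayley_walk_map[of S T, OF S] TT by metis
  ultimately show ?thesis by (simp add: cayley_isometry_def cayley_dist_def)
qed

text \<open>Multiplication by 5 permutes the generators (it swaps 4 and 8, and 3 and 9 are fixed),
  and \<open>25 = 1\<close> modulo 12. The condition on \<open>w\<close> is
  \<open>a * w + w = 0\<close> for \<open>a = 5\<close>; it holds for 2 and 10.\<close>

lemma swapping_affine_isometryI:
  fixes w :: 12
  assumes w: "6 * w = 0" and "(\<lambda>x. 5 * x + w) ` K = D"
  shows "swapping_affine_isometry {3, 4, 8, 9} K D (\<lambda>x. 5 * x + w)"
proof -
  let ?T = "\<lambda>x. 5 * x + w"
  have w': "5 * w + w = 0" using w by (simp add: algebra_simps)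
  have inv: "?T \<circ> ?T = id"
  proof
    fix x
    have "(?T \<circ> ?T) x = 25 * x + (5 * w + w)" by (simp add: algebra_simps)
    then show "(?T \<circ> ?T) x = id x" using w' by (simp add: numerals_mod_12)
  qed
  have "affine_transformation ?T"
    unfolding affine_transformation_12_iff[OF inv] using w' by (intro exI[of _ 5] exI[of _ w]) simp
  moreover have "cayley_isometry {3, 4, 8, 9} ?T"
  proof (rule involution_cayley_isometry[OF _ inv])
    fix x y :: 12
    assume "y - x \<in> {3, 4, 8, 9}"
    moreover have "5 * d \<in> {3, 4, 8, 9}" if "d \<in> {3, 4, 8, 9}" for d :: 12
      using that by (elim insertE emptyE) (simp_all add: numerals_mod_12)
    ultimately have "5 * (y - x) \<in> {3, 4, 8, 9}" by blast
    moreover have "5 * y + w - (5 * x + w) = 5 * (y - x)" by (simp add: algebra_simps)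
    ultimately show "5 * y + w - (5 * x + w) \<in> {3, 4, 8, 9}" by simp
  qed
  ultimately show ?thesis using inv assms(2) by (simp add: swapping_affine_isometry_def)
qed

lemma affine_involution_12_cases:
  fixes a w :: 12
  assumes "a * a = 1" and "a * w + w = 0"
    and free: "\<And>x. a * x + w \<noteq> x"
    and disjoint: "\<And>x. x \<in> {0, 3, 4, 8, 9} \<Longrightarrow> a * x + w \<notin> {0, 3, 4, 8, 9}"
  shows "a = 5 \<and> w \<in> {2, 10}"
proof -
  have a: "a \<in> {1, 5, 7, 11}"
    using cases_12[of a] assms(1) by (elim insertE emptyE) simp_all
  \<comment> \<open>\<open>disjoint[of 0]\<close> puts \<open>w\<close> outside K'. For
    \<open>a = 11\<close>, the values 2 and 10 of \<open>w\<close> pass all disjointness tests; they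
    are refuted by the fixed points 1, 7 and 5, 11 respectively.\<close>
  show ?thesis
    using a cases_12[of w] assms(2) free[of 1] free[of 5] free[of 7] free[of 11] disjoint[of 0]
      disjoint[of 3] disjoint[of 4] disjoint[of 8] disjoint[of 9]
    by (elim insertE emptyE) simp_all
qed

lemma swapping_affine_isometryD:
  fixes K D :: "12 set"
  assumes "is_bipartition K D" and "{0, 3, 4, 8, 9} \<subseteq> K"
    and "swapping_affine_isometry {3, 4, 8, 9} K D T"
  shows "T = (\<lambda>x. 5 * x + 2) \<and>
           (K, D) \<in> {({0, 3, 4, 7, 8, 9}, {1, 2, 5, 6, 10, 11}), ({0, 1, 3, 4, 8, 9}, {2, 5, 6, 7, 10, 11})} \<or>
         T = (\<lambda>x. 5 * x + 10) \<and>
           (K, D) \<in> {({0, 3, 4, 5, 8, 9}, {1, 2, 6, 7, 10, 11}), ({0, 3, 4, 8, 9, 11}, {1, 2, 5, 6, 7, 10})}"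
proof -
  have D: "D = - K" using assms(1) by (auto simp: is_bipartition_def)
  have inv: "T \<circ> T = id" and "affine_transformation T" and TK: "T ` K = - K"
    using assms(3) D by (simp_all add: swapping_affine_isometry_def)
  then obtain a w where aw: "a * a = 1" "a * w + w = 0" and T: "T = (\<lambda>x. a * x + w)"
    using affine_transformation_12_iff by blast
  have swap: "T x \<in> K \<longleftrightarrow> x \<notin> K" for x
  proof
    have TT: "T (T x) = x" using inv by (simp add: fun_eq_iff)
    show "T x \<in> K \<Longrightarrow> x \<notin> K" using TK by blast
    show "x \<notin> K \<Longrightarrow> T x \<in> K"
    proof -
      assume "x \<notin> K"
      then obtain y where "y \<in> K" "x = T y" using TK by blast
      then show "T x \<in> K" using inv by (simp add: fun_eq_iff)
    qed
  qed
  have "a = 5 \<and> w \<in> {2, 10}"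
    using aw
  proof (rule affine_involution_12_cases)
    \<comment> \<open>A fixed point would lie both in \<open>K\<close> and in its
      complement.\<close>
    show "a * x + w \<noteq> x" for x using swap[of x] T by auto
    show "a * x + w \<notin> {0, 3, 4, 8, 9}" if "x \<in> {0, 3, 4, 8, 9}" for x
      using swap[of x] T that assms(2) by auto
  qed
  moreover have K': "0 \<in> K" "3 \<in> K" "4 \<in> K" "8 \<in> K" "9 \<in> K" using assms(2) by auto
  note swaps = swap[of 0] swap[of 1] swap[of 3] swap[of 4] swap[of 5] swap[of 8] swap[of 9]
  ultimately consider "T = (\<lambda>x. 5 * x + 2)" | "T = (\<lambda>x. 5 * x + 10)" using T by auto
  then show ?thesis
  proof cases
    case 1
    then show ?thesis
      \<comment> \<open>The orbits are {0,2}, {1,7}, {3,5}, {4,10}, {6,8}, {9,11}; only {1,7} misses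
        K'.\<close>
      using K' swaps by (cases "1 \<in> K") (simp_all add: D set_eq_iff all_12_iff numerals_mod_12)
  next
    case 2
    then show ?thesis
      \<comment> \<open>The orbits are {0,10}, {1,3}, {2,8}, {4,6}, {5,11}, {7,9}; only {5,11}
        misses K'.\<close>
      using K' swaps by (cases "5 \<in> K") (simp_all add: D set_eq_iff all_12_iff numerals_mod_12)
  qed
qed

theorem theorem4p13:
  fixes S K' :: "12 set"
    and K1 D1 K2 D2 K3 D3 K4 D4 :: "12 set"
  assumes "S = {3, 4, 8, 9}" and "K' = {0} \<union> S"
    and "K1 = {0, 3, 4, 7, 8, 9}" and "D1 = {1, 2, 5, 6, 10, 11}"
    and "K2 = {0, 1, 3, 4, 8, 9}" and "D2 = {2, 5, 6, 7, 10, 11}"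
    and "K3 = {0, 3, 4, 5, 8, 9}" and "D3 = {1, 2, 6, 7, 10, 11}"
    and "K4 = {0, 3, 4, 8, 9, 11}" and "D4 = {1, 2, 5, 6, 7, 10}"
  shows "{(K, D). is_bipartition K D \<and> K' \<subseteq> K \<and> (\<exists>!T. swapping_affine_isometry S K D T)}
             = {(K1, D1), (K2, D2), (K3, D3), (K4, D4)}
         \<and> card {(K1, D1), (K2, D2), (K3, D3), (K4, D4)} = 4
         \<and> (\<forall>T. swapping_affine_isometry S K1 D1 T \<longleftrightarrow> T = (\<lambda>x. 5 * x + 2))
         \<and> (\<forall>T. swapping_affine_isometry S K2 D2 T \<longleftrightarrow> T = (\<lambda>x. 5 * x + 2))
         \<and> (\<forall>T. swapping_affine_isometry S K3 D3 T \<longleftrightarrow> T = (\<lambda>x. 5 * x + 10))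
         \<and> (\<forall>T. swapping_affine_isometry S K4 D4 T \<longleftrightarrow> T = (\<lambda>x. 5 * x + 10))"
proof -
  define R :: "(12 set \<times> 12 set \<times> (12 \<Rightarrow> 12)) set"
    where "R = {(K1, D1, \<lambda>x. 5 * x + 2), (K2, D2, \<lambda>x. 5 * x + 2),
                (K3, D3, \<lambda>x. 5 * x + 10), (K4, D4, \<lambda>x. 5 * x + 10)}"
  have only: "(K, D, T) \<in> R"
    if "is_bipartition K D" "K' \<subseteq> K" "swapping_affine_isometry S K D T" for K D T
  proof -
    have "{0, 3, 4, 8, 9} \<subseteq> K" using that(2) by (simp add: assms(1,2))
    from swapping_affine_isometryD[OF that(1) this that(3)[unfolded assms(1)]]
    show ?thesis unfolding R_def assms(3-) by (elim disjE conjE insertE emptyE) (simp_all only: prod.inject simp_thms insert_iff)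
  qed
  have part: "is_bipartition K D \<and> K' \<subseteq> K" if "(K, D, T) \<in> R" for K D T
    using that unfolding R_def assms is_bipartition_def
    by (elim insertE emptyE) (simp_all add: set_eq_iff all_12_iff)
  have image: "(\<lambda>x. 5 * x + 2) ` K1 = D1" "(\<lambda>x. 5 * x + 2) ` K2 = D2"
    "(\<lambda>x. 5 * x + 10) ` K3 = D3" "(\<lambda>x. 5 * x + 10) ` K4 = D4"
    unfolding assms by (simp_all add: set_eq_iff all_12_iff numerals_mod_12)
  have "swapping_affine_isometry S K1 D1 (\<lambda>x. 5 * x + 2)"
    "swapping_affine_isometry S K2 D2 (\<lambda>x. 5 * x + 2)"
    "swapping_affine_isometry S K3 D3 (\<lambda>x. 5 * x + 10)"
    "swapping_affine_isometry S K4 D4 (\<lambda>x. 5 * x + 10)"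
    unfolding assms(1) by (rule swapping_affine_isometryI, simp, rule image)+
  then have swap: "swapping_affine_isometry S K D T" if "(K, D, T) \<in> R" for K D T
    using that unfolding R_def by blast
  have distinct: "K1 \<noteq> K2" "K1 \<noteq> K3" "K1 \<noteq> K4" "K2 \<noteq> K3" "K2 \<noteq> K4" "K3 \<noteq> K4"
    unfolding assms by (simp_all add: set_eq_iff all_12_iff)
  have unique: "swapping_affine_isometry S K D T' \<longleftrightarrow> T' = T" if "(K, D, T) \<in> R" for K D T T'
  proof -
    \<comment> \<open>The sets \<open>K1\<close> to \<open>K4\<close> are distinct, so the first
      component of a triple in \<open>R\<close> determines its map.\<close>
    have "T' = T" if "(K, D, T') \<in> R"
      using that \<open>(K, D, T) \<in> R\<close> distinct unfolding R_def by auto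
    then show ?thesis using only part swap that by metis
  qed
  \<comment> \<open>Existence of one swapping map already puts the triple in \<open>R\<close>, and
    there the map is unique.\<close>
  have "is_bipartition K D \<and> K' \<subseteq> K \<and> (\<exists>!T. swapping_affine_isometry S K D T) \<longleftrightarrow>
      (\<exists>T. (K, D, T) \<in> R)" for K D
    using only part unique by metis
  then have "{(K, D). is_bipartition K D \<and> K' \<subseteq> K \<and> (\<exists>!T. swapping_affine_isometry S K D T)}
        = {(K, D). \<exists>T. (K, D, T) \<in> R}"
    by simp
  also have "\<dots> = {(K1, D1), (K2, D2), (K3, D3), (K4, D4)}"
    unfolding R_def by auto
  finally show ?thesis
    using distinct unique by (simp add: R_def)
qed

end
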